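(* Let $\phi:\mathbb{R}\to\mathbb{R}$ be strictly convex and twice continuously differentiable, with $\phi'(0)=0$ and $\phi(0)<0$. Let $f:\mathbb{R}^n\to\mathbb{R}$, $f(x)=\phi(\|x\|)$, let $K=\operatorname{epi}(f)\subset\mathbb{R}^{n+1}$ and $U=\{(x,0)\mid x\in\mathbb{R}^n\}\subset\mathbb{R}^{n+1}$. Let $(z^k,0)_{k\in\mathbb{N}}$ and $(x^k,0)_{k\in\mathbb{N}}$ be the sequences generated by MAP and CRM for the pair $K,U$, starting from some $(z^0,0)\in\mathbb{R}^{n+1}$ and some $(x^0,0)\in U$, respectively, and assume that neither sequence reaches its limit in finitely many steps. Then the MAP sequence converges Q-linearly to a point $(z^*,0)\in K\cap U$, with asymptotic constant equal to $\dfrac{1}{1+\phi'(\|z^*\|)^2}$, and the CRM sequence converges (Q-)superlinearly.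
   Context: $\operatorname{epi}(f)$ is the epigraph of $f$ in $\mathbb{R}^{n+1}=\mathbb{R}^n\times\mathbb{R}$. $P_K,P_U$ are the orthogonal projections onto $K,U$; $R_K=2P_K-\mathrm{Id}$, $R_U=2P_U-\mathrm{Id}$. MAP iterates the operator $T=P_U\circ P_K$. CRM iterates the operator $C(w)=\operatorname{circ}(w,R_K(w),R_U(R_K(w)))$, where $\operatorname{circ}(a,b,c)$ is the point of the affine hull of $\{a,b,c\}$ equidistant from $a,b,c$; it is known that $C(w)$ is well defined and belongs to $U$ for every $w\in U$ when $K\cap U\ne\emptyset$. It is also known that both sequences converge to points in $K\cap U$. For a sequence $(y^k)$ converging to $y^*$ with $y^k\ne y^*$ for all $k$, the (Q-)asymptotic constant is $q=\limsup_{k\to\infty}\|y^{k+1}-y^*\|/\|y^k-y^*\|$; the convergence is Q-linear if $q\in(0,1)$ and Q-superlinear if $q=0$. *)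

theory Defs
  imports "HOL-Analysis.Analysis"
begin

definition strictly_convex_on :: "'a::real_vector set \<Rightarrow> ('a \<Rightarrow> real) \<Rightarrow> bool" where
  "strictly_convex_on S f \<longleftrightarrow> convex S \<and>
     (\<forall>x\<in>S. \<forall>y\<in>S. \<forall>t. x \<noteq> y \<and> 0 < t \<and> t < 1 \<longrightarrow>
        f ((1 - t) *\<^sub>R x + t *\<^sub>R y) < (1 - t) * f x + t * f y)"

definition twice_continuously_differentiable :: "(real \<Rightarrow> real) \<Rightarrow> bool" where
  "twice_continuously_differentiable g \<longleftrightarrow>
     (\<forall>t. g differentiable (at t)) \<and> deriv g C1_differentiable_on UNIV"

definition reflection :: "'a::euclidean_space set \<Rightarrow> 'a \<Rightarrow> 'a" where
  "reflection S w = 2 *\<^sub>R closest_point S w - w"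

(* At most one point satisfies the description: a difference of two such points is both parallel
   and orthogonal to the affine hull.  None exists if a, b, c are distinct and collinear, and
   the value is then unspecified. *)
definition circ :: "'a::euclidean_space \<Rightarrow> 'a \<Rightarrow> 'a \<Rightarrow> 'a" where
  "circ a b c = (THE p. p \<in> affine hull {a, b, c} \<and> dist p a = dist p b \<and> dist p b = dist p c)"

definition MAP_op :: "'a::euclidean_space set \<Rightarrow> 'a set \<Rightarrow> 'a \<Rightarrow> 'a" where
  "MAP_op K U = closest_point U \<circ> closest_point K"

definition CRM_op :: "'a::euclidean_space set \<Rightarrow> 'a set \<Rightarrow> 'a \<Rightarrow> 'a" where
  "CRM_op K U w = circ w (reflection K w) (reflection U (reflection K w))"

definition MAP_seq :: "'a::euclidean_space set \<Rightarrow> 'a set \<Rightarrow> 'a \<Rightarrow> nat \<Rightarrow> 'a" where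
  "MAP_seq K U w k = (MAP_op K U ^^ k) w"

definition CRM_seq :: "'a::euclidean_space set \<Rightarrow> 'a set \<Rightarrow> 'a \<Rightarrow> nat \<Rightarrow> 'a" where
  "CRM_seq K U w k = (CRM_op K U ^^ k) w"

definition reaches_limit :: "(nat \<Rightarrow> 'a::real_normed_vector) \<Rightarrow> bool" where
  "reaches_limit y \<longleftrightarrow> (\<exists>L k. y \<longlonglongrightarrow> L \<and> y k = L)"

(* Extended-real valued, since the limsup of the quotients may be infinite. *)
definition asymptotic_constant :: "(nat \<Rightarrow> 'a::real_normed_vector) \<Rightarrow> 'a \<Rightarrow> ereal" where
  "asymptotic_constant y L = limsup (\<lambda>k. ereal (norm (y (Suc k) - L) / norm (y k - L)))"

definition Q_linear_convergence :: "(nat \<Rightarrow> 'a::real_normed_vector) \<Rightarrow> 'a \<Rightarrow> bool" where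
  "Q_linear_convergence y L \<longleftrightarrow> y \<longlonglongrightarrow> L \<and> (\<forall>k. y k \<noteq> L) \<and>
     0 < asymptotic_constant y L \<and> asymptotic_constant y L < 1"

definition Q_superlinear_convergence :: "(nat \<Rightarrow> 'a::real_normed_vector) \<Rightarrow> 'a \<Rightarrow> bool" where
  "Q_superlinear_convergence y L \<longleftrightarrow> y \<longlonglongrightarrow> L \<and> (\<forall>k. y k \<noteq> L) \<and>
     asymptotic_constant y L = 0"

end

theory Submission
  imports Defs
begin

text \<open>
  The problem is rotationally symmetric, and both methods reduce to iterations on the half line
  \<open>(r, \<infinity>)\<close>, where \<open>r\<close> is the positive zero of \<open>\<phi>\<close>; the set \<open>K \<inter> U\<close> is the ball of
  radius \<open>r\<close>.  A start in this ball would be a fixed point of either operator, so neither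
  start lies in it.

  Let \<open>e\<close> be a unit vector and \<open>s > r\<close>.  The normal to the graph of \<open>f\<close> at \<open>(t e, \<phi> t)\<close>
  has direction \<open>(\<phi>' t e, -1)\<close>, so it meets \<open>U\<close> at \<open>(s e, 0)\<close> exactly when
  \<open>s = t + \<phi> t * \<phi>' t\<close>.  Such a \<open>t\<close> exists between \<open>r\<close> and \<open>s\<close>, and then
  \<open>(t e, \<phi> t)\<close> is the projection of \<open>(s e, 0)\<close> onto \<open>K\<close> (\<open>closest_point_rot_epi\<close>).
  Hence MAP sends the radius \<open>s\<close> to \<open>t\<close>.  The circumcentre lies in \<open>U\<close>, by
  symmetry, and on the tangent hyperplane of \<open>K\<close> at the projection; hence CRM sends \<open>s\<close> to \<open>t - \<phi> t / \<phi>' t\<close>, which is the Newton step for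
  \<open>\<phi>\<close> from \<open>t\<close> (\<open>CRM_op_ray\<close>).

  The rates follow.  Near \<open>r\<close>, \<open>s - r = (t - r) + \<phi> t * \<phi>' t\<close> is asymptotically
  \<open>(1 + (\<phi>' r)^2) * (t - r)\<close>, which gives the MAP constant (\<open>foot_rate\<close>); and the Newton step makes
  \<open>t - r\<close> smaller by a factor tending to \<open>0\<close>, which is the superlinearity of CRM
  (\<open>newton_rate\<close>).  Convergence itself comes from the bound \<open>(1 + (\<phi>' r)^2) * (t - r) \<le> s - r\<close>, valid for every
  \<open>s > r\<close> because \<open>\<phi>\<close>
  lies above its tangent at \<open>r\<close> and \<open>\<phi>'\<close> increases; the Newton step stays in \<open>(r, t)\<close>.
\<close>

section \<open>Characterisations of projections and circumcentres\<close>

text \<open>The variational inequality gives \<open>(dist w z)^2 \<ge> (dist w p)^2 + (dist z p)^2\<close>, so \<open>p\<close> is the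
  strict minimiser of the distance to \<open>w\<close>.\<close>

lemma closest_point_eqI:
  fixes w p :: "'a::euclidean_space"
  assumes "p \<in> S" and var: "\<And>z. z \<in> S \<Longrightarrow> inner (z - p) (w - p) \<le> 0"
  shows "closest_point S w = p"
proof -
  have expand: "(dist w z)\<^sup>2 = (dist w p)\<^sup>2 + (dist z p)\<^sup>2 - 2 * inner (z - p) (w - p)" for z
    unfolding dist_norm power2_norm_eq_inner
    by (simp add: inner_diff_left inner_diff_right inner_commute)
  have min: "\<forall>z\<in>S. dist w p \<le> dist w z"
  proof
    fix z assume "z \<in> S"
    then have "(dist w p)\<^sup>2 \<le> (dist w z)\<^sup>2"
      using expand[of z] var[of z] zero_le_power2[of "dist z p"] by linarith
    then show "dist w p \<le> dist w z" by (rule power2_le_imp_le) simp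
  qed
  show ?thesis unfolding closest_point_def
  proof (rule some_equality)
    show "p \<in> S \<and> (\<forall>z\<in>S. dist w p \<le> dist w z)" using assms(1) min by blast
  next
    fix x assume x: "x \<in> S \<and> (\<forall>z\<in>S. dist w x \<le> dist w z)"
    then have "dist w x \<le> dist w p" using assms(1) by blast
    then have "(dist w x)\<^sup>2 \<le> (dist w p)\<^sup>2" by (rule power_mono) simp
    then have "(dist x p)\<^sup>2 \<le> 0" using expand[of x] var[of x] x by linarith
    then show "x = p" by simp
  qed
qed

lemma circ_eqI:
  fixes a b c p :: "'a::euclidean_space"
  assumes p: "p \<in> affine hull {a, b, c}" and "dist p a = dist p b" "dist p b = dist p c"
  shows "circ a b c = p"
  unfolding circ_def
proof (rule the_equality)
  show "p \<in> affine hull {a, b, c} \<and> dist p a = dist p b \<and> dist p b = dist p c"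
    using assms by blast
next
  fix q assume q: "q \<in> affine hull {a, b, c} \<and> dist q a = dist q b \<and> dist q b = dist q c"
  \<comment> \<open>Both points lie on the bisecting hyperplanes of \<open>a, b\<close> and of \<open>b, c\<close>, so their difference
    is orthogonal to \<open>b - a\<close> and \<open>c - a\<close>, but also a combination of these.\<close>
  have bisect: "2 * inner x (v - u) = inner v v - inner u u" if "dist x u = dist x v" for x u v :: 'a
  proof -
    have "(dist x u)\<^sup>2 = (dist x v)\<^sup>2" using that by simp
    then show ?thesis unfolding dist_norm power2_norm_eq_inner
      by (simp add: inner_diff_left inner_diff_right inner_commute)
  qed
  have orth_b: "inner (q - p) (b - a) = 0"
    using bisect[of p a b] bisect[of q a b] assms(2) q by (simp add: inner_diff_left)
  have orth_c: "inner (q - p) (c - a) = 0"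
    using bisect[of p a c] bisect[of q a c] assms(2,3) q by (simp add: inner_diff_left)
  obtain u1 v1 w1 where p1: "p = u1 *\<^sub>R a + v1 *\<^sub>R b + w1 *\<^sub>R c" "u1 + v1 + w1 = 1"
    using p unfolding affine_hull_3 by blast
  obtain u2 v2 w2 where q1: "q = u2 *\<^sub>R a + v2 *\<^sub>R b + w2 *\<^sub>R c" "u2 + v2 + w2 = 1"
    using q unfolding affine_hull_3 by blast
  have u: "u1 = 1 - v1 - w1" "u2 = 1 - v2 - w2" using p1(2) q1(2) by auto
  have "q - p = (v2 - v1) *\<^sub>R (b - a) + (w2 - w1) *\<^sub>R (c - a)"
    unfolding p1(1) q1(1) u by (simp add: algebra_simps)
  then have "inner (q - p) (q - p) = inner (q - p) ((v2 - v1) *\<^sub>R (b - a) + (w2 - w1) *\<^sub>R (c - a))"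
    by simp
  also have "\<dots> = 0" using orth_b orth_c by (simp add: inner_add_right)
  finally show "q = p" by simp
qed

text \<open>On \<open>K \<inter> U\<close> both reflections are the identity, and the degenerate circumcentre of one point is
  this point; so an iteration that starts in \<open>K \<inter> U\<close> stops at once.\<close>

lemma MAP_seq_reaches_limit:
  assumes "w \<in> K \<inter> U" shows "reaches_limit (MAP_seq K U w)"
proof -
  have "MAP_op K U w = w" using assms by (simp add: MAP_op_def closest_point_self)
  then have "MAP_seq K U w k = w" for k by (induction k) (simp_all add: MAP_seq_def)
  then have "MAP_seq K U w = (\<lambda>k. w)" by blast
  then show ?thesis unfolding reaches_limit_def by auto
qed

lemma CRM_seq_reaches_limit:
  assumes "w \<in> K \<inter> U" shows "reaches_limit (CRM_seq K U w)"
proof -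
  have "reflection K w = w" "reflection U w = w"
    using assms by (simp_all add: reflection_def closest_point_self scaleR_2)
  moreover have "circ w w w = w" by (rule circ_eqI) simp_all
  ultimately have "CRM_op K U w = w" by (simp add: CRM_op_def)
  then have "CRM_seq K U w k = w" for k by (induction k) (simp_all add: CRM_seq_def)
  then have "CRM_seq K U w = (\<lambda>k. w)" by blast
  then show ?thesis unfolding reaches_limit_def by auto
qed

section \<open>Scalar contractions on a half line\<close>

lemma iterates_contract:
  fixes \<Phi> :: "real \<Rightarrow> real"
  assumes above: "\<And>s. r < s \<Longrightarrow> r < \<Phi> s"
    and contr: "\<And>s. r < s \<Longrightarrow> \<Phi> s - r \<le> \<kappa> * (s - r)" and \<kappa>: "0 \<le> \<kappa>" "\<kappa> < 1"
    and s0: "r < s0"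
  shows "r < (\<Phi> ^^ k) s0" and "(\<lambda>k. (\<Phi> ^^ k) s0) \<longlonglongrightarrow> r"
proof -
  show gt: "r < (\<Phi> ^^ k) s0" for k by (induction k) (simp_all add: s0 above)
  have le: "(\<Phi> ^^ k) s0 - r \<le> \<kappa> ^ k * (s0 - r)" for k
  proof (induction k)
    case (Suc k)
    have "(\<Phi> ^^ Suc k) s0 - r \<le> \<kappa> * ((\<Phi> ^^ k) s0 - r)" using contr[OF gt[of k]] by simp
    also have "\<dots> \<le> \<kappa> * (\<kappa> ^ k * (s0 - r))" using Suc \<kappa>(1) by (rule mult_left_mono)
    finally show ?case by simp
  qed simp
  have "(\<lambda>k. \<kappa> ^ k * (s0 - r)) \<longlonglongrightarrow> 0 * (s0 - r)"
    using \<kappa> by (intro tendsto_mult tendsto_const LIMSEQ_power_zero) simp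
  then have "(\<lambda>k. \<kappa> ^ k * (s0 - r)) \<longlonglongrightarrow> 0" by simp
  then have "(\<lambda>k. (\<Phi> ^^ k) s0 - r) \<longlonglongrightarrow> 0"
    by (rule tendsto_sandwich[rotated 3, where f = "\<lambda>k. 0"])
      (use gt le in \<open>auto intro!: always_eventually less_imp_le simp: algebra_simps\<close>)
  then show "(\<lambda>k. (\<Phi> ^^ k) s0) \<longlonglongrightarrow> r" using Lim_null by blast
qed

text \<open>If an operator acts on the ray \<open>{(s e, 0) | s > r}\<close> through a scalar contraction \<open>\<Phi>\<close>
  towards \<open>r\<close>, the error quotients of its iterates are those of \<open>\<Phi>\<close>, since \<open>e\<close> is a unit
  vector.\<close>

lemma radial_iteration:
  fixes op :: "('a::euclidean_space \<times> real) \<Rightarrow> 'a \<times> real"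
  assumes e: "norm e = 1"
    and op: "\<And>s. r < s \<Longrightarrow> op (s *\<^sub>R e, 0) = (\<Phi> s *\<^sub>R e, 0)"
    and above: "\<And>s. r < s \<Longrightarrow> r < \<Phi> s"
    and contr: "\<And>s. r < s \<Longrightarrow> \<Phi> s - r \<le> \<kappa> * (s - r)" and \<kappa>: "0 \<le> \<kappa>" "\<kappa> < 1"
    and rate: "((\<lambda>s. (\<Phi> s - r) / (s - r)) \<longlongrightarrow> q) (at_right r)"
    and s0: "r < s0"
  defines "y \<equiv> \<lambda>k. (op ^^ k) (s0 *\<^sub>R e, 0)" and "L \<equiv> (r *\<^sub>R e, 0)"
  shows "y \<longlonglongrightarrow> L" and "y k \<noteq> L" and "asymptotic_constant y L = ereal q"
proof -
  define \<sigma> where "\<sigma> k = (\<Phi> ^^ k) s0" for k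
  have gt: "r < \<sigma> k" for k
    unfolding \<sigma>_def using above contr \<kappa> s0 by (rule iterates_contract)
  have lim: "\<sigma> \<longlonglongrightarrow> r"
    unfolding \<sigma>_def using above contr \<kappa> s0 by (rule iterates_contract)
  have y: "y k = (\<sigma> k *\<^sub>R e, 0)" for k
  proof (induction k)
    case 0 then show ?case by (simp add: y_def \<sigma>_def)
  next
    case (Suc k)
    have "y (Suc k) = op (y k)" by (simp add: y_def)
    also have "\<dots> = (\<sigma> (Suc k) *\<^sub>R e, 0)" unfolding Suc op[OF gt] by (simp add: \<sigma>_def)
    finally show ?case .
  qed
  have norm_diff: "norm (y k - L) = \<sigma> k - r" for k
  proof -
    have "y k - L = ((\<sigma> k - r) *\<^sub>R e, 0)" by (simp add: y L_def scaleR_diff_left)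
    then show ?thesis using gt[of k] e by (simp add: norm_Pair)
  qed
  show "y k \<noteq> L" using norm_diff[of k] gt[of k] by auto
  have "(\<lambda>k. norm (y k - L)) \<longlonglongrightarrow> 0"
    unfolding norm_diff using lim by (simp add: LIM_zero)
  then show "y \<longlonglongrightarrow> L" using Lim_null tendsto_norm_zero_iff by blast
  have "filterlim \<sigma> (at_right r) sequentially"
    using lim gt by (auto simp: filterlim_at intro!: always_eventually)
  then have "(\<lambda>k. (\<Phi> (\<sigma> k) - r) / (\<sigma> k - r)) \<longlonglongrightarrow> q"
    by (rule filterlim_compose[OF rate])
  then have "(\<lambda>k. ereal (norm (y (Suc k) - L) / norm (y k - L))) \<longlonglongrightarrow> ereal q"
    unfolding norm_diff by (intro tendsto_ereal) (simp add: \<sigma>_def)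
  then show "asymptotic_constant y L = ereal q"
    unfolding asymptotic_constant_def by (intro lim_imp_Limsup) simp_all
qed

section \<open>The profile of the epigraph\<close>

lemma strictly_convex_above_tangent:
  assumes sc: "strictly_convex_on UNIV \<phi>" and D: "(\<phi> has_real_derivative m) (at x)" and "x \<noteq> y"
  shows "\<phi> x + m * (y - x) < \<phi> y"
proof -
  have strict: "\<phi> ((1 - t) * u + t * v) < (1 - t) * \<phi> u + t * \<phi> v"
    if "u \<noteq> v" "0 < t" "t < 1" for t u v :: real
    using sc that unfolding strictly_convex_on_def by auto
  have "\<phi> ((1 - t) * u + t * v) \<le> (1 - t) * \<phi> u + t * \<phi> v"
    if "0 < t" "t < 1" for t u v :: real
    using strict[of u v t] that by (cases "u = v") (auto simp: algebra_simps)
  then have convex: "convex_on UNIV \<phi>" by (intro convex_onI) auto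
  \<comment> \<open>The weak tangent inequality at the midpoint, combined with strict convexity there.\<close>
  have "\<phi> z - \<phi> x \<ge> m * (z - x)" for z
    using convex by (rule convex_on_imp_above_tangent) (use D in auto)
  from this[of "(1 - 1/2) * x + 1/2 * y"] strict[OF assms(3), of "1/2"]
  show ?thesis by (simp add: field_simps)
qed

locale radial_profile =
  fixes \<phi> \<phi>' :: "real \<Rightarrow> real" and r :: real
  assumes strictly_convex: "strictly_convex_on UNIV \<phi>"
    and deriv: "\<And>t. (\<phi> has_real_derivative \<phi>' t) (at t)"
    and deriv_continuous: "continuous_on UNIV \<phi>'"
    and deriv_zero: "\<phi>' 0 = 0"
    and root_pos: "0 < r" and root: "\<phi> r = 0"

context radial_profile
begin

lemma above_tangent: "\<phi> x + \<phi>' x * (y - x) \<le> \<phi> y"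
  using strictly_convex_above_tangent[OF strictly_convex deriv] by (cases "x = y") force+

lemma deriv_mono: assumes "x \<le> y" shows "\<phi>' x \<le> \<phi>' y"
proof (cases "x = y")
  case False
  have "\<phi>' x * (y - x) \<le> \<phi>' y * (y - x)"
    using above_tangent[of x y] above_tangent[of y x] by (simp add: algebra_simps)
  then show ?thesis using False assms by simp
qed simp

lemma deriv_pos: assumes "0 < t" shows "0 < \<phi>' t"
proof -
  have "\<phi> 0 < \<phi> t" "\<phi> t + \<phi>' t * (0 - t) < \<phi> 0"
    using strictly_convex_above_tangent[OF strictly_convex deriv, of 0 t]
      strictly_convex_above_tangent[OF strictly_convex deriv, of t 0] assms deriv_zero by auto
  then have "0 < \<phi>' t * t" by simp
  then show ?thesis using assms by (simp add: zero_less_mult_iff)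
qed

lemma deriv_root_pos: "0 < \<phi>' r"
  using deriv_pos root_pos .

lemma profile_lower: "\<phi>' r * (t - r) \<le> \<phi> t"
  using above_tangent[of r t] root by simp

lemma profile_pos: assumes "r < t" shows "0 < \<phi> t"
  using profile_lower[of t] mult_pos_pos[OF deriv_root_pos, of "t - r"] assms by simp

lemma profile_nonpos: assumes "0 \<le> t" "t \<le> r" shows "\<phi> t \<le> 0"
proof -
  have "0 \<le> \<phi>' t" using deriv_mono[OF assms(1)] deriv_zero by simp
  then have "0 \<le> \<phi>' t * (r - t)" using assms by simp
  then show ?thesis using above_tangent[of t r] root by simp
qed

lemma foot_exists:
  assumes "r < s" shows "\<exists>t. r < t \<and> t < s \<and> t + \<phi> t * \<phi>' t = s"
proof -
  have cont: "isCont (\<lambda>t. t + \<phi> t * \<phi>' t) t" for t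
    using deriv_continuous DERIV_isCont[OF deriv]
    by (intro continuous_intros) (auto simp: continuous_on_eq_continuous_at)
  have "0 < \<phi> s * \<phi>' s" using profile_pos deriv_pos root_pos assms by simp
  then obtain t where t: "r \<le> t" "t \<le> s" "t + \<phi> t * \<phi>' t = s"
    using IVT[of "\<lambda>t. t + \<phi> t * \<phi>' t" r s s] assms root cont by auto
  have "r < t" using t assms root by (cases "r = t") auto
  moreover have "0 < \<phi> t * \<phi>' t" using profile_pos deriv_pos root_pos \<open>r < t\<close> by simp
  ultimately show ?thesis using t by auto
qed

text \<open>The radius of the projection of \<open>(s e, 0)\<close> onto the epigraph.\<close>

definition foot :: "real \<Rightarrow> real" where
  "foot s = (SOME t. r < t \<and> t < s \<and> t + \<phi> t * \<phi>' t = s)"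

definition newton :: "real \<Rightarrow> real" where
  "newton t = t - \<phi> t / \<phi>' t"

lemma foot:
  assumes "r < s"
  shows "r < foot s" "foot s < s" "foot s + \<phi> (foot s) * \<phi>' (foot s) = s"
  using someI_ex[OF foot_exists[OF assms]] unfolding foot_def by auto

lemma newton_bounds:
  assumes "r < t" shows "r < newton t" "newton t < t"
proof -
  have d: "0 < \<phi>' t" "0 < \<phi> t" using deriv_pos profile_pos root_pos assms by auto
  have "\<phi> t < \<phi>' t * (t - r)"
    using strictly_convex_above_tangent[OF strictly_convex deriv, of t r] assms root
    by (simp add: algebra_simps)
  then have "\<phi> t / \<phi>' t < t - r" using d by (simp add: divide_simps mult.commute)
  then show "r < newton t" by (simp add: newton_def)
  show "newton t < t" using d by (simp add: newton_def)
qed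

text \<open>In \<open>s - r = (t - r) + \<phi> t * \<phi>' t\<close> the two factors are at least \<open>\<phi>' r * (t - r)\<close> and
  \<open>\<phi>' r\<close>.\<close>

lemma foot_contraction:
  assumes "r < s" shows "foot s - r \<le> 1 / (1 + (\<phi>' r)\<^sup>2) * (s - r)"
proof -
  define t where "t = foot s"
  have t: "r < t" "t + \<phi> t * \<phi>' t = s" using foot[OF assms] by (auto simp: t_def)
  have "(\<phi>' r * (t - r)) * \<phi>' r \<le> \<phi> t * \<phi>' t"
    using profile_lower deriv_mono[of r t] deriv_root_pos profile_pos[of t] t
    by (intro mult_mono) auto
  then have "(1 + (\<phi>' r)\<^sup>2) * (t - r) \<le> s - r" using t
    by (simp add: algebra_simps power2_eq_square)
  moreover have "0 < 1 + (\<phi>' r)\<^sup>2" by (simp add: add_pos_nonneg)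
  ultimately show ?thesis by (simp add: t_def field_simps)
qed

lemma contraction_factor: "0 < 1 / (1 + (\<phi>' r)\<^sup>2)" "1 / (1 + (\<phi>' r)\<^sup>2) < 1"
  using deriv_root_pos by (auto simp: add_pos_nonneg)

lemma filterlim_foot: "filterlim foot (at_right r) (at_right r)"
proof -
  have "(foot \<longlongrightarrow> r) (at_right r)"
  proof (rule tendsto_sandwich[where f = "\<lambda>s. r" and h = "\<lambda>s. s"])
    show "\<forall>\<^sub>F s in at_right r. r \<le> foot s" "\<forall>\<^sub>F s in at_right r. foot s \<le> s"
      using foot by (auto simp: eventually_at_filter intro!: always_eventually less_imp_le)
  qed (auto intro: tendsto_eq_intros)
  moreover have "\<forall>\<^sub>F s in at_right r. foot s \<in> {r<..} \<and> foot s \<noteq> r"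
    unfolding eventually_at_filter by (intro always_eventually) (auto dest: foot(1))
  ultimately show ?thesis by (simp add: filterlim_at)
qed

lemma profile_slope: "((\<lambda>t. \<phi> t / (t - r)) \<longlongrightarrow> \<phi>' r) (at_right r)"
proof -
  have "((\<lambda>t. \<phi> t / (t - r)) \<longlongrightarrow> \<phi>' r) (at r)"
    using deriv[of r] root unfolding has_field_derivative_iff by simp
  then show ?thesis by (rule tendsto_mono[rotated]) (simp add: at_le)
qed

lemma deriv_tendsto: "(\<phi>' \<longlongrightarrow> \<phi>' r) (at_right r)"
  using deriv_continuous unfolding continuous_on_def
  by (meson UNIV_I at_le subset_UNIV tendsto_mono)

lemma foot_rate: "((\<lambda>s. (foot s - r) / (s - r)) \<longlongrightarrow> 1 / (1 + (\<phi>' r)\<^sup>2)) (at_right r)"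
proof -
  have "((\<lambda>t. 1 / (1 + \<phi> t / (t - r) * \<phi>' t)) \<longlongrightarrow> 1 / (1 + \<phi>' r * \<phi>' r)) (at_right r)"
    using contraction_factor(1)
    by (intro tendsto_intros profile_slope deriv_tendsto) (auto simp: power2_eq_square)
  then have "((\<lambda>s. 1 / (1 + \<phi> (foot s) / (foot s - r) * \<phi>' (foot s))) \<longlongrightarrow> 1 / (1 + (\<phi>' r)\<^sup>2))
      (at_right r)"
    using filterlim_compose[OF _ filterlim_foot] by (fastforce simp: power2_eq_square)
  moreover have "1 / (1 + \<phi> (foot s) / (foot s - r) * \<phi>' (foot s)) = (foot s - r) / (s - r)"
    if "r < s" for s
  proof -
    define t where "t = foot s"
    have t: "0 < t - r" "s - r = (t - r) + \<phi> t * \<phi>' t" using foot[OF that] by (auto simp: t_def)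
    then have "1 + \<phi> t / (t - r) * \<phi>' t = (s - r) / (t - r)" by (simp add: field_simps)
    then show ?thesis by (simp add: t_def)
  qed
  then have "\<forall>\<^sub>F s in at_right r.
      1 / (1 + \<phi> (foot s) / (foot s - r) * \<phi>' (foot s)) = (foot s - r) / (s - r)"
    by (auto simp: eventually_at_filter intro!: always_eventually)
  ultimately show ?thesis by (rule Lim_transform_eventually)
qed

lemma newton_rate: "((\<lambda>t. (newton t - r) / (t - r)) \<longlongrightarrow> 0) (at_right r)"
proof -
  have "((\<lambda>t. 1 - \<phi> t / (t - r) / \<phi>' t) \<longlongrightarrow> 1 - \<phi>' r / \<phi>' r) (at_right r)"
    using deriv_root_pos by (intro tendsto_intros profile_slope deriv_tendsto) auto
  then have "((\<lambda>t. 1 - \<phi> t / (t - r) / \<phi>' t) \<longlongrightarrow> 0) (at_right r)"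
    using deriv_root_pos by simp
  moreover have "1 - \<phi> t / (t - r) / \<phi>' t = (newton t - r) / (t - r)" if "r < t" for t
    using that deriv_pos[of t] root_pos by (simp add: newton_def field_simps)
  then have "\<forall>\<^sub>F t in at_right r. 1 - \<phi> t / (t - r) / \<phi>' t = (newton t - r) / (t - r)"
    by (auto simp: eventually_at_filter intro!: always_eventually)
  ultimately show ?thesis by (rule Lim_transform_eventually)
qed

lemma newton_foot_rate: "((\<lambda>s. (newton (foot s) - r) / (s - r)) \<longlongrightarrow> 0) (at_right r)"
proof -
  have "((\<lambda>s. (newton (foot s) - r) / (foot s - r)) \<longlongrightarrow> 0) (at_right r)"
    using newton_rate filterlim_foot by (rule filterlim_compose)
  from tendsto_mult[OF this foot_rate]
  have "((\<lambda>s. (newton (foot s) - r) / (foot s - r) * ((foot s - r) / (s - r))) \<longlongrightarrow> 0) (at_right r)"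
    by simp
  moreover have "\<forall>\<^sub>F s in at_right r. (newton (foot s) - r) / (foot s - r) * ((foot s - r) / (s - r))
      = (newton (foot s) - r) / (s - r)"
    unfolding eventually_at_filter by (intro always_eventually) (auto dest: foot(1))
  ultimately show ?thesis by (rule Lim_transform_eventually)
qed

section \<open>MAP and CRM on a ray\<close>

definition rot_epi :: "('a::euclidean_space \<times> real) set" where
  "rot_epi = epigraph UNIV (\<lambda>x. \<phi> (norm x))"

end

definition ground :: "('a::euclidean_space \<times> real) set" where
  "ground = {(x, 0) | x. True}"

lemma closest_point_ground:
  fixes x :: "'a::euclidean_space"
  shows "closest_point ground (x, h) = (x, 0)"
  by (rule closest_point_eqI) (auto simp: ground_def inner_prod_def)

context radial_profile
begin

lemma rot_epi_ground_iff:
  fixes x :: "'a::euclidean_space"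
  shows "(x, 0) \<in> rot_epi \<inter> ground \<longleftrightarrow> norm x \<le> r"
  using profile_pos[of "norm x"] profile_nonpos[of "norm x"]
  by (force simp: rot_epi_def ground_def epigraph_def not_le)

text \<open>With \<open>t = foot s\<close>, the vector from \<open>(t e, \<phi> t)\<close> to \<open>(s e, 0)\<close> is \<open>\<phi> t\<close> times the outer
  normal \<open>(\<phi>' t e, -1)\<close>.  The variational inequality is then the tangent inequality for \<open>\<phi>\<close> at
  \<open>t\<close>, with \<open>inner y e \<le> norm y\<close> and \<open>\<phi>' t > 0\<close>.\<close>

lemma closest_point_rot_epi:
  fixes e :: "'a::euclidean_space"
  assumes e: "norm e = 1" and s: "r < s"
  shows "closest_point rot_epi (s *\<^sub>R e, 0) = (foot s *\<^sub>R e, \<phi> (foot s))"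
proof (rule closest_point_eqI)
  define t where "t = foot s"
  have t: "r < t" "s - t = \<phi> t * \<phi>' t" using foot[OF s] by (auto simp: t_def)
  have pos: "0 < \<phi> t" "0 < \<phi>' t" "0 < t" using profile_pos deriv_pos root_pos t by auto
  show "(foot s *\<^sub>R e, \<phi> (foot s)) \<in> rot_epi"
    using e pos by (simp add: rot_epi_def epigraph_def t_def)
  have ee: "inner e e = 1" using e by (simp add: norm_eq_1)
  fix z :: "'a \<times> real" assume z: "z \<in> rot_epi"
  obtain y \<eta> where z_eq: "z = (y, \<eta>)" by (cases z)
  then have \<eta>: "\<phi> (norm y) \<le> \<eta>" using z by (simp add: rot_epi_def epigraph_def)
  have "inner y e \<le> norm y" using norm_cauchy_schwarz[of y e] e by simp
  then have "\<phi>' t * (inner y e - t) \<le> \<phi>' t * (norm y - t)"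
    using pos by (intro mult_left_mono) auto
  also have "\<dots> \<le> \<eta> - \<phi> t" using above_tangent[of t "norm y"] \<eta> by simp
  finally have "\<phi> t * (\<phi>' t * (inner y e - t) - (\<eta> - \<phi> t)) \<le> 0"
    using pos by (intro mult_nonneg_nonpos) auto
  moreover have "inner (z - (t *\<^sub>R e, \<phi> t)) ((s *\<^sub>R e, 0) - (t *\<^sub>R e, \<phi> t))
      = (s - t) * (inner y e - t) - \<phi> t * (\<eta> - \<phi> t)"
    by (simp add: z_eq inner_prod_def inner_diff_left inner_diff_right ee algebra_simps)
  ultimately show "inner (z - (foot s *\<^sub>R e, \<phi> (foot s))) ((s *\<^sub>R e, 0) - (foot s *\<^sub>R e, \<phi> (foot s))) \<le> 0"
    unfolding t_def[symmetric] t(2) by (simp add: algebra_simps)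
qed

lemma MAP_op_ray:
  fixes e :: "'a::euclidean_space"
  assumes "norm e = 1" "r < s"
  shows "MAP_op rot_epi ground (s *\<^sub>R e, 0) = (foot s *\<^sub>R e, 0)"
  using assms by (simp add: MAP_op_def closest_point_rot_epi closest_point_ground)

lemma CRM_op_ray:
  fixes e :: "'a::euclidean_space"
  assumes e: "norm e = 1" and s: "r < s"
  shows "CRM_op rot_epi ground (s *\<^sub>R e, 0) = (newton (foot s) *\<^sub>R e, 0)"
proof -
  define t c where "t = foot s" and "c = newton t"
  have t: "r < t" "s = t + \<phi> t * \<phi>' t" using foot[OF s] by (auto simp: t_def)
  have pos: "0 < \<phi> t" "0 < \<phi>' t" using profile_pos deriv_pos root_pos t by auto
  then have "s \<noteq> t" using t by simp
  define A B C where "A = (s *\<^sub>R e, 0::real)" and "B = ((2 * t - s) *\<^sub>R e, 2 * \<phi> t)"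
    and "C = ((2 * t - s) *\<^sub>R e, - 2 * \<phi> t)"
  have B: "reflection rot_epi A = B"
    using closest_point_rot_epi[OF e s]
    by (simp add: reflection_def A_def B_def t_def scaleR_diff_left)
  have C: "reflection ground B = C"
    by (simp add: reflection_def B_def C_def closest_point_ground flip: scaleR_diff_left)
  have "circ A B C = (c *\<^sub>R e, 0)"
  proof (rule circ_eqI)
    \<comment> \<open>\<open>(c e, 0)\<close> lies on the line through \<open>A\<close> and the midpoint of \<open>B, C\<close>, whose radii are \<open>s\<close>
      and \<open>2 * t - s\<close>; so \<open>B\<close> and \<open>C\<close> share the weight \<open>(s - c) / (2 * (s - t))\<close>.\<close>
    define v where "v = (s - c) / (4 * (s - t))"
    have "4 * v * (s - t) = s - c" using \<open>s \<noteq> t\<close> by (simp add: v_def field_simps)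
    then have c_eq: "c = (1 - 2 * v) * s + v * (2 * t - s) + v * (2 * t - s)"
      by (simp add: algebra_simps)
    have "(c *\<^sub>R e, 0) = (1 - 2 * v) *\<^sub>R A + v *\<^sub>R B + v *\<^sub>R C"
      unfolding A_def B_def C_def by (subst c_eq) (simp flip: scaleR_add_left)
    then show "(c *\<^sub>R e, 0) \<in> affine hull {A, B, C}"
      unfolding affine_hull_3 by (intro CollectI exI[of _ "1 - 2 * v"] exI[of _ v]) simp
    have dist_ray: "dist (c *\<^sub>R e, 0) (a *\<^sub>R e, h) = sqrt ((c - a)\<^sup>2 + h\<^sup>2)" for a h
      using e by (simp add: dist_norm norm_Pair flip: scaleR_diff_left)
    \<comment> \<open>In terms of the Newton displacement \<open>d\<close>, the radii are \<open>s - c = d * m^2 + d\<close> and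
      \<open>c - (2 * t - s) = d * m^2 - d\<close> with \<open>m = \<phi>' t\<close>.\<close>
    define d where "d = \<phi> t / \<phi>' t"
    have d: "\<phi> t = d * \<phi>' t" "c = t - d" using pos by (simp_all add: d_def c_def newton_def)
    have "(c - s)\<^sup>2 + 0\<^sup>2 = (c - (2 * t - s))\<^sup>2 + (2 * \<phi> t)\<^sup>2"
      unfolding t(2) d by (simp add: power2_eq_square algebra_simps)
    then show "dist (c *\<^sub>R e, 0) A = dist (c *\<^sub>R e, 0) B"
      unfolding A_def B_def dist_ray by simp
    show "dist (c *\<^sub>R e, 0) B = dist (c *\<^sub>R e, 0) C"
      unfolding B_def C_def dist_ray by simp
  qed
  then show ?thesis unfolding CRM_op_def A_def[symmetric] B C by (simp add: c_def t_def)
qed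

lemma MAP_asymptotics:
  fixes e :: "'a::euclidean_space"
  assumes "norm e = 1" "r < s0"
  defines "y \<equiv> MAP_seq rot_epi ground (s0 *\<^sub>R e, 0)"
  shows "asymptotic_constant y (r *\<^sub>R e, 0) = ereal (1 / (1 + (\<phi>' r)\<^sup>2))"
    and "Q_linear_convergence y (r *\<^sub>R e, 0)"
proof -
  have y: "y = (\<lambda>k. (MAP_op rot_epi ground ^^ k) (s0 *\<^sub>R e, 0))"
    by (simp add: y_def MAP_seq_def fun_eq_iff)
  note conv = radial_iteration[OF assms(1) MAP_op_ray[OF assms(1)] foot(1) foot_contraction
      less_imp_le[OF contraction_factor(1)] contraction_factor(2) foot_rate assms(2)]
  show const: "asymptotic_constant y (r *\<^sub>R e, 0) = ereal (1 / (1 + (\<phi>' r)\<^sup>2))"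
    unfolding y by (rule conv(3))
  show "Q_linear_convergence y (r *\<^sub>R e, 0)"
    unfolding Q_linear_convergence_def const
    unfolding y using conv(1,2) contraction_factor by (auto simp del: less_divide_eq_1_pos)
qed

lemma CRM_asymptotics:
  fixes e :: "'a::euclidean_space"
  assumes "norm e = 1" "r < s0"
  shows "Q_superlinear_convergence (CRM_seq rot_epi ground (s0 *\<^sub>R e, 0)) (r *\<^sub>R e, 0)"
proof -
  have y: "CRM_seq rot_epi ground (s0 *\<^sub>R e, 0) = (\<lambda>k. (CRM_op rot_epi ground ^^ k) (s0 *\<^sub>R e, 0))"
    by (simp add: CRM_seq_def fun_eq_iff)
  have "newton (foot s) - r \<le> 1 / (1 + (\<phi>' r)\<^sup>2) * (s - r)" if "r < s" for s
    using newton_bounds(2)[OF foot(1)[OF that]] foot_contraction[OF that] by linarith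
  note conv = radial_iteration[OF assms(1) CRM_op_ray[OF assms(1)] newton_bounds(1)[OF foot(1)] this
      less_imp_le[OF contraction_factor(1)] contraction_factor(2) newton_foot_rate assms(2)]
  show ?thesis
    unfolding Q_superlinear_convergence_def y using conv by (simp add: zero_ereal_def)
qed

end

text \<open>Beyond \<open>1\<close> the profile grows at least with the slope \<open>\<phi>' 1 > 0\<close>, so it becomes
  nonnegative.\<close>

lemma radial_profile_exists:
  assumes sc: "strictly_convex_on UNIV \<phi>"
    and D: "\<And>t. (\<phi> has_real_derivative \<phi>' t) (at t)"
    and cont: "continuous_on UNIV \<phi>'"
    and "\<phi>' 0 = 0" "\<phi> 0 < 0"
  shows "\<exists>r. radial_profile \<phi> \<phi>' r"
proof -
  note tangent = strictly_convex_above_tangent[OF sc D]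
  have slope: "0 < \<phi>' 1" using tangent[of 0 1] tangent[of 1 0] assms(4) by simp
  define b where "b = 1 + \<bar>\<phi> 1\<bar> / \<phi>' 1"
  have b: "\<phi>' 1 * (b - 1) = \<bar>\<phi> 1\<bar>" "1 \<le> b" using slope by (simp_all add: b_def)
  have "\<phi> 1 + \<phi>' 1 * (b - 1) \<le> \<phi> b" using tangent[of 1 b] by (cases "b = 1") auto
  then have "0 \<le> \<phi> b" using b(1) by linarith
  then obtain r where r: "0 \<le> r" "\<phi> r = 0"
    using IVT[of \<phi> 0 0 b] assms(5) b(2) DERIV_isCont[OF D] by auto
  have "r \<noteq> 0" using r assms(5) by auto
  then have "radial_profile \<phi> \<phi>' r" using r assms by unfold_locales auto
  then show ?thesis ..
qed

theorem corollary4p11: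
  fixes \<phi> :: "real \<Rightarrow> real"
    and f :: "real ^ 'n \<Rightarrow> real"
    and K U :: "((real ^ 'n) \<times> real) set"
    and z0 x0 :: "real ^ 'n"
  assumes "strictly_convex_on UNIV \<phi>"
    and "twice_continuously_differentiable \<phi>"
    and "deriv \<phi> 0 = 0"
    and "\<phi> 0 < 0"
    and "f = (\<lambda>x. \<phi> (norm x))"
    and "K = epigraph UNIV f"
    and "U = {(x, 0) | x. True}"
    and "\<not> reaches_limit (MAP_seq K U (z0, 0))"
    and "\<not> reaches_limit (CRM_seq K U (x0, 0))"
  shows "(\<exists>zs. (zs, 0) \<in> K \<inter> U \<and>
            Q_linear_convergence (MAP_seq K U (z0, 0)) (zs, 0) \<and>
            asymptotic_constant (MAP_seq K U (z0, 0)) (zs, 0)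
              = ereal (1 / (1 + (deriv \<phi> (norm zs))\<^sup>2))) \<and>
         (\<exists>xs. Q_superlinear_convergence (CRM_seq K U (x0, 0)) (xs, 0))"
proof -
  have D: "(\<phi> has_real_derivative deriv \<phi> t) (at t)" for t
    using assms(2) unfolding twice_continuously_differentiable_def
    using DERIV_deriv_iff_real_differentiable by blast
  have cont: "continuous_on UNIV (deriv \<phi>)"
    using assms(2) C1_differentiable_imp_continuous_on
    unfolding twice_continuously_differentiable_def by blast
  obtain r where "radial_profile \<phi> (deriv \<phi>) r"
    using radial_profile_exists[OF assms(1) D cont assms(3,4)] by blast
  then interpret radial_profile \<phi> "deriv \<phi>" r .
  have K: "K = rot_epi" and U: "U = ground"
    using assms(5-7) by (simp_all add: rot_epi_def ground_def)
  have z0: "r < norm z0"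
    using assms(8) MAP_seq_reaches_limit rot_epi_ground_iff[of z0] unfolding K U by fastforce
  have x0: "r < norm x0"
    using assms(9) CRM_seq_reaches_limit rot_epi_ground_iff[of x0] unfolding K U by fastforce
  have unit: "norm (sgn z0) = 1" "norm (sgn x0) = 1"
    using z0 x0 root_pos by (auto simp: norm_sgn)
  have polar: "norm x *\<^sub>R sgn x = x" for x :: "real ^ 'n"
    by (cases "x = 0") (simp_all add: sgn_div_norm)
  have norm_lim: "norm (r *\<^sub>R sgn z0) = r" using unit root_pos by simp
  show ?thesis
  proof (intro conjI exI)
    show "(r *\<^sub>R sgn z0, 0) \<in> K \<inter> U" unfolding K U rot_epi_ground_iff norm_lim by simp
    show "Q_linear_convergence (MAP_seq K U (z0, 0)) (r *\<^sub>R sgn z0, 0)"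
      using MAP_asymptotics(2)[OF unit(1) z0] unfolding K U polar .
    show "asymptotic_constant (MAP_seq K U (z0, 0)) (r *\<^sub>R sgn z0, 0)
        = ereal (1 / (1 + (deriv \<phi> (norm (r *\<^sub>R sgn z0)))\<^sup>2))"
      using MAP_asymptotics(1)[OF unit(1) z0] unfolding K U polar norm_lim .
    show "Q_superlinear_convergence (CRM_seq K U (x0, 0)) (r *\<^sub>R sgn x0, 0)"
      using CRM_asymptotics[OF unit(2) x0] unfolding K U polar .
  qed
qed

end
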